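(* Let $\lambda$ be a real Pisot–Vijayaraghavan number of degree $n$ with $|\lambda|>1$, whose minimal polynomial $z^n+c_{n-1}z^{n-1}+\cdots+c_0$ has roots $\lambda=\lambda_1,\lambda_2,\dots,\lambda_n$, and suppose $|c_0|=1$. Let $\sigma\in\mathbb{R}^n_a$. Then $$\xi=[\,0,(1-|\lambda_2|)\sigma_2,\dots,(1-|\lambda_n|)\sigma_n\,]^T\in\mathbb{R}^n_a.$$ Moreover, let $m\ge 1$, $a_1,\dots,a_m\in\mathbb{C}\setminus\{0\}$ with $a_1+\cdots+a_m=|\lambda|$, let $\tau_1<\cdots<\tau_m$ be real numbers with $\tau_j\in\mathfrak{L}(\xi)$ for all $j$, and let $f$ be the compactly supported distribution on $\mathbb{R}$ with $\int f(x)\,dx=1$ and $f(x)=\sum_{j=1}^m a_jf(\lambda x-\tau_j)$. Then the spaces $$W_k=\operatorname{span}\{\,f(\lambda^kx-\tau):\tau\in\mathfrak{L}(\sigma)\,\},\qquad k\in\mathbb{Z},$$ satisfy $W_k\subset W_{k+1}$ for all $k\in\mathbb{Z}$.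
   Context: An algebraic integer $\lambda$ is a Pisot–Vijayaraghavan (PV) number if the roots $\lambda=\lambda_1,\dots,\lambda_n$ of its minimal polynomial satisfy $|\lambda_j|<1$ for $j=2,\dots,n$. A vector $\sigma\in\mathbb{R}^n$ is admissible if $\sigma_1=0$, $\sigma_j>0$ for $j\ge2$, and $\sigma_j=\sigma_k$ whenever $2\le j<k\le n$ and $\lambda_j,\lambda_k$ are a nonreal complex conjugate pair; $\mathbb{R}^n_a$ is the set of admissible vectors. Let $V$ be the $n\times n$ Vandermonde matrix with entries $V_{i,j}=\lambda_j^{i-1}$, so $(V^T\ell)_j=\sum_{i=1}^n\ell_i\lambda_j^{i-1}$ for $\ell\in\mathbb{Z}^n$. The quasilattice corresponding to $\sigma\in\mathbb{R}^n_a$ is $$\mathfrak{L}(\sigma)=\{(V^T\ell)_1:\ell\in\mathbb{Z}^n\text{ and }|(V^T\ell)_j|<\sigma_j\text{ for all }2\le j\le n\}\subset\mathbb{R}.$$ Span means the set of finite complex linear combinations, and $\subset$ allows equality. *)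

theory Defs
  imports "HOL-Analysis.Analysis" "HOL-Computational_Algebra.Computational_Algebra"
begin

subsection \<open>Pisot--Vijayaraghavan numbers, admissible vectors and quasilattices\<close>

definition minimal_polynomial :: "complex \<Rightarrow> rat poly" where
  "minimal_polynomial x =
     (THE p. lead_coeff p = 1 \<and> poly (map_poly of_rat p) x = 0 \<and>
             (\<forall>q. q \<noteq> 0 \<and> poly (map_poly of_rat q) x = 0 \<longrightarrow> degree p \<le> degree q))"

text \<open>Throughout, vectors of length \<open>n\<close> are functions on \<open>nat\<close> of which only the values at the
  indices \<open>1, \<dots>, n\<close> matter. In \<open>conjugate_list x n r\<close>, the vector \<open>r\<close> lists the roots of the
  minimal polynomial of \<open>x\<close>, with \<open>x\<close> itself in first position.\<close>

definition conjugate_list :: "complex \<Rightarrow> nat \<Rightarrow> (nat \<Rightarrow> complex) \<Rightarrow> bool" where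
  "conjugate_list x n r \<longleftrightarrow>
     degree (minimal_polynomial x) = n \<and>
     map_poly of_rat (minimal_polynomial x) = (\<Prod>j=1..n. [:- r j, 1:]) \<and>
     r 1 = x"

definition PV_number :: "complex \<Rightarrow> bool" where
  "PV_number x \<longleftrightarrow>
     algebraic_int x \<and> (\<exists>n r. conjugate_list x n r \<and> (\<forall>j\<in>{2..n}. cmod (r j) < 1))"

definition admissible :: "nat \<Rightarrow> (nat \<Rightarrow> complex) \<Rightarrow> (nat \<Rightarrow> real) set" where
  "admissible n r =
     {\<sigma>. \<sigma> 1 = 0 \<and> (\<forall>j\<in>{2..n}. \<sigma> j > 0) \<and>
         (\<forall>j k. 2 \<le> j \<and> j < k \<and> k \<le> n \<and> r j \<notin> \<real> \<and> r k = cnj (r j) \<longrightarrow> \<sigma> j = \<sigma> k)}"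

definition vandermonde :: "(nat \<Rightarrow> complex) \<Rightarrow> nat \<Rightarrow> nat \<Rightarrow> complex" where
  "vandermonde r i j = r j ^ (i - 1)"

text \<open>The \<open>j\<close>-th entry of the product of the transposed Vandermonde matrix with \<open>l\<close>.\<close>

definition vandermonde_transpose_mult ::
  "nat \<Rightarrow> (nat \<Rightarrow> complex) \<Rightarrow> (nat \<Rightarrow> int) \<Rightarrow> nat \<Rightarrow> complex" where
  "vandermonde_transpose_mult n r l j = (\<Sum>i=1..n. vandermonde r i j * of_int (l i))"

text \<open>A set of real numbers: it is used for real \<open>r 1\<close>, so that the first entry of the product is
  always real.\<close>

definition quasilattice :: "nat \<Rightarrow> (nat \<Rightarrow> complex) \<Rightarrow> (nat \<Rightarrow> real) \<Rightarrow> real set" where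
  "quasilattice n r \<sigma> =
     {x. \<exists>l. complex_of_real x = vandermonde_transpose_mult n r l 1 \<and>
             (\<forall>j\<in>{2..n}. cmod (vandermonde_transpose_mult n r l j) < \<sigma> j)}"

subsection \<open>Distributions on the real line\<close>

definition iter_deriv :: "nat \<Rightarrow> (real \<Rightarrow> complex) \<Rightarrow> real \<Rightarrow> complex" where
  "iter_deriv k = (\<lambda>g x. vector_derivative g (at x)) ^^ k"

definition fun_support :: "(real \<Rightarrow> complex) \<Rightarrow> real set" where
  "fun_support \<phi> = closure {x. \<phi> x \<noteq> 0}"

definition test_functions :: "(real \<Rightarrow> complex) set" where
  "test_functions =
     {\<phi>. (\<forall>k x. iter_deriv k \<phi> differentiable (at x)) \<and> compact (fun_support \<phi>)}"

text \<open>Distributions are the linear functionals on test functions that satisfy the usual seminorm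
  estimates on each compact set, which is sequential continuity. They are extended by 0 to
  functions that are not test functions, so that equality of distributions is equality in HOL.\<close>

definition distributions :: "((real \<Rightarrow> complex) \<Rightarrow> complex) set" where
  "distributions =
     {u. (\<forall>\<phi>. \<phi> \<notin> test_functions \<longrightarrow> u \<phi> = 0) \<and>
         (\<forall>\<phi>\<in>test_functions. \<forall>\<psi>\<in>test_functions. \<forall>b c.
            u (\<lambda>x. b * \<phi> x + c * \<psi> x) = b * u \<phi> + c * u \<psi>) \<and>
         (\<forall>K. compact K \<longrightarrow>
            (\<exists>C N. \<forall>\<phi>\<in>test_functions. fun_support \<phi> \<subseteq> K \<longrightarrow>
               cmod (u \<phi>) \<le> C * (\<Sum>k\<le>N. SUP x. cmod (iter_deriv k \<phi> x))))}"

definition dist_support :: "((real \<Rightarrow> complex) \<Rightarrow> complex) \<Rightarrow> real set" where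
  "dist_support u =
     - \<Union>{U. open U \<and> (\<forall>\<phi>\<in>test_functions. fun_support \<phi> \<subseteq> U \<longrightarrow> u \<phi> = 0)}"

definition compactly_supported_distributions :: "((real \<Rightarrow> complex) \<Rightarrow> complex) set" where
  "compactly_supported_distributions = {u \<in> distributions. compact (dist_support u)}"

text \<open>The integral of a compactly supported distribution is its pairing with the constant
  function 1, that is, with any test function equal to 1 near the support.\<close>

definition dist_integral :: "((real \<Rightarrow> complex) \<Rightarrow> complex) \<Rightarrow> complex" where
  "dist_integral u =
     (THE c. \<forall>\<psi>\<in>test_functions.
        (\<exists>U. open U \<and> dist_support u \<subseteq> U \<and> (\<forall>x\<in>U. \<psi> x = 1)) \<longrightarrow> u \<psi> = c)"

text \<open>For \<open>b \<noteq> 0\<close>, \<open>affine_pullback b t u\<close> is the distribution \<open>u(b x - t)\<close>: substitute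
  \<open>y = b x - t\<close> in the integral of \<open>u(b x - t) \<phi>(x)\<close>.\<close>

definition affine_pullback ::
  "real \<Rightarrow> real \<Rightarrow> ((real \<Rightarrow> complex) \<Rightarrow> complex) \<Rightarrow> (real \<Rightarrow> complex) \<Rightarrow> complex" where
  "affine_pullback b t u \<phi> = u (\<lambda>y. \<phi> ((y + t) / b) / complex_of_real \<bar>b\<bar>)"

definition complex_span ::
  "((real \<Rightarrow> complex) \<Rightarrow> complex) set \<Rightarrow> ((real \<Rightarrow> complex) \<Rightarrow> complex) set" where
  "complex_span S = {(\<lambda>\<phi>. \<Sum>u\<in>T. c u * u \<phi>) | T c. finite T \<and> T \<subseteq> S}"

definition scaling_space ::
  "real \<Rightarrow> real set \<Rightarrow> ((real \<Rightarrow> complex) \<Rightarrow> complex) \<Rightarrow> int \<Rightarrow> ((real \<Rightarrow> complex) \<Rightarrow> complex) set"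
  where
  "scaling_space lam L f k = complex_span ((\<lambda>\<tau>. affine_pullback (lam powi k) \<tau> f) ` L)"

end

theory Submission
  imports Defs
begin

text \<open>
  Substituting the refinement equation into itself gives
  \<open>f(\<lambda>\<^sup>k x - \<tau>) = \<Sum>j. a\<^sub>j f(\<lambda>\<^sup>k\<^sup>+\<^sup>1 x - (\<lambda>\<tau> + \<tau>\<^sub>j))\<close>, so \<open>W\<^sub>k \<subseteq> W\<^sub>k\<^sub>+\<^sub>1\<close> holds as soon as
  \<open>\<lambda>\<tau> + \<tau>\<^sub>j\<close> lies in \<open>\<LL>(\<sigma>)\<close> for \<open>\<tau> \<in> \<LL>(\<sigma>)\<close> and \<open>\<tau>\<^sub>j \<in> \<LL>(\<xi>)\<close>. Think of an integer vector \<open>l\<close>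
  as the element \<open>\<Sum>i. l\<^sub>i \<lambda>\<^sup>i\<^sup>-\<^sup>1\<close> of \<open>\<int>[\<lambda>]\<close>; the entries of \<open>V\<^sup>T l\<close> are its conjugates. Because the
  minimal polynomial is monic with integer coefficients, \<open>\<int>[\<lambda>]\<close> is closed under multiplication by
  \<open>\<lambda>\<close>, which multiplies the \<open>j\<close>-th conjugate by \<open>\<lambda>\<^sub>j\<close>. So the \<open>j\<close>-th conjugate of \<open>\<lambda>\<tau> + \<tau>\<^sub>j\<close> is
  bounded by \<open>|\<lambda>\<^sub>j| \<sigma>\<^sub>j + (1 - |\<lambda>\<^sub>j|) \<sigma>\<^sub>j = \<sigma>\<^sub>j\<close>; the radii \<open>\<xi>\<close> are chosen for exactly this
  (\<open>mult_add_in_quasilattice\<close>).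

  The minimal polynomial is a polynomial over the rationals. That its coefficients are integers when
  \<open>\<lambda>\<close> is an algebraic integer is Gauss's lemma
  (\<open>monic_rat_factor_of_int_poly\<close>, \<open>minimal_polynomial_int_coeffs\<close>).
\<close>

section \<open>Integrality of the minimal polynomial\<close>

lemma map_poly_of_rat_mult:
  "map_poly (of_rat :: rat \<Rightarrow> 'a::field_char_0) (p * q) = map_poly of_rat p * map_poly of_rat q"
  by (intro poly_eqI) (simp add: coeff_map_poly coeff_mult of_rat_sum of_rat_mult)

lemma map_poly_of_int_mult:
  "map_poly (of_int :: int \<Rightarrow> 'a::comm_ring_1) (p * q) = map_poly of_int p * map_poly of_int q"
  by (intro poly_eqI) (simp add: coeff_map_poly coeff_mult)

lemma map_poly_of_rat_add:
  "map_poly (of_rat :: rat \<Rightarrow> 'a::field_char_0) (p + q) = map_poly of_rat p + map_poly of_rat q"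
  by (intro poly_eqI) (simp add: coeff_map_poly of_rat_add)

lemma clear_denominators:
  fixes q :: "rat poly"
  obtains d h where "d > 0" "map_poly of_int h = smult (of_int d) q"
proof -
  have "\<exists>d h. d > 0 \<and> map_poly of_int h = smult (of_int d) q"
  proof (induction q)
    case 0
    show ?case by (intro exI[of _ 1] exI[of _ 0]) auto
  next
    case (pCons a q)
    then obtain d h where dh: "d > 0" "map_poly of_int h = smult (of_int d) q"
      by auto
    obtain u v where uv: "v > 0" "a = of_int u / of_int v"
      by (metis quotient_of_denom_pos quotient_of_div surj_pair)
    have "map_poly of_int (smult v h) = smult (of_int (d * v)) q"
      by (subst map_poly_smult) (use dh in \<open>auto simp: mult.commute\<close>)
    then have "map_poly of_int (pCons (d * u) (smult v h)) = smult (of_int (d * v)) (pCons a q)"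
      by (subst map_poly_pCons) (use uv in auto)
    then show ?case using dh(1) uv(1) by (metis mult_pos_pos)
  qed
  then show ?thesis using that by blast
qed

text \<open>Gauss's lemma: after clearing denominators in both factors by \<open>d\<close> and \<open>e\<close>, the leading
  coefficients are \<open>d\<close> and \<open>e\<close>, so the contents divide \<open>d\<close> and \<open>e\<close>. The product of the contents
  is \<open>d e\<close>, because a monic polynomial is primitive; hence they equal \<open>d\<close> and \<open>e\<close>, and the
  denominators divide out again.\<close>

lemma monic_rat_factor_of_int_poly:
  fixes g s :: "rat poly" and p :: "int poly"
  assumes p: "map_poly of_int p = g * s" and monic: "lead_coeff p = 1" "lead_coeff g = 1"
  shows "coeff g i \<in> \<int>"
proof -
  have "lead_coeff (map_poly rat_of_int p) = 1"
    using monic by (simp add: lead_coeff_map_poly_nz)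
  then have s1: "lead_coeff s = 1"
    using p monic by (simp add: lead_coeff_mult)
  obtain d G where d: "d > 0" "map_poly of_int G = smult (of_int d) g"
    by (rule clear_denominators)
  obtain e S where e: "e > 0" "map_poly of_int S = smult (of_int e) s"
    by (rule clear_denominators)
  have G: "of_int (coeff G k) = of_int d * coeff g k" for k
    by (metis coeff_map_poly coeff_smult d(2) of_int_0)
  have S: "of_int (coeff S k) = of_int e * coeff s k" for k
    by (metis coeff_map_poly coeff_smult e(2) of_int_0)
  have lc: "coeff G (degree g) = d" "coeff S (degree s) = e"
    using G[of "degree g"] S[of "degree s"] monic s1 by auto
  have "map_poly rat_of_int (G * S) = map_poly of_int (smult (d * e) p)"
    unfolding map_poly_of_int_mult d e
    by (subst map_poly_smult) (auto simp: p mult.commute)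
  then have prod: "G * S = smult (d * e) p"
    by (metis (no_types, lifting) coeff_map_poly of_int_0 of_int_eq_iff poly_eqI)
  have "content p dvd lead_coeff p" by (rule content_dvd_coeff)
  then have "is_unit (content p)" using monic by simp
  then have "content p = 1"
    by (metis is_unit_normalize normalize_content)
  then have "content G * content S = d * e"
    using arg_cong[OF prod, of content] d(1) e(1)
    by (simp add: content_mult abs_mult)
  moreover have "content G \<le> d" "content S \<le> e"
    using content_dvd_coeff[of G "degree g"] content_dvd_coeff[of S "degree s"] lc d(1) e(1)
    by (auto intro: zdvd_imp_le)
  moreover have "content G \<ge> 0" "content S \<ge> 0"
    by (metis abs_ge_zero normalize_content normalize_int_def)+
  ultimately have "d * e \<le> content G * e" by (metis mult_left_mono)
  then have "content G = d" using e(1) \<open>content G \<le> d\<close> by simp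
  then have "d dvd coeff G i"
    by (metis content_dvd_coeff)
  then obtain c where "coeff G i = d * c" by (elim dvdE)
  then have "coeff g i = of_int c" using G[of i] d(1) by simp
  then show ?thesis by simp
qed

text \<open>The minimal polynomial divides every rational polynomial \<open>q\<close> that vanishes at \<open>x\<close>: the
  remainder of \<open>q\<close> vanishes too and would have smaller degree.\<close>

lemma minimal_degree_dvd:
  fixes x :: complex and p q :: "rat poly"
  assumes "p \<noteq> 0" and "poly (map_poly of_rat p) x = 0"
    and min: "\<And>q. q \<noteq> 0 \<Longrightarrow> poly (map_poly of_rat q) x = 0 \<Longrightarrow> degree p \<le> degree q"
    and "poly (map_poly of_rat q) x = 0"
  shows "p dvd q"
proof (rule ccontr)
  assume "\<not> p dvd q"
  then have nz: "q mod p \<noteq> 0" by (simp add: dvd_eq_mod_eq_0)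
  have "map_poly (of_rat :: rat \<Rightarrow> complex) q = map_poly of_rat (q div p * p + q mod p)"
    by simp
  then have "poly (map_poly of_rat (q mod p)) x = 0"
    using assms(2,4) by (simp only: map_poly_of_rat_add map_poly_of_rat_mult) simp
  then have "degree p \<le> degree (q mod p)" using min nz by blast
  then show False using degree_mod_less'[OF \<open>p \<noteq> 0\<close> nz] by simp
qed

lemma minimal_polynomial_spec:
  assumes "q0 \<noteq> 0" "poly (map_poly of_rat q0) x = 0"
  shows "lead_coeff (minimal_polynomial x) = 1"
    and "poly (map_poly of_rat (minimal_polynomial x)) x = 0"
    and "\<And>q. poly (map_poly of_rat q) x = 0 \<Longrightarrow> minimal_polynomial x dvd q"
proof -
  define P where "P p \<longleftrightarrow> lead_coeff p = 1 \<and> poly (map_poly of_rat p) x = 0 \<and>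
     (\<forall>q. q \<noteq> 0 \<and> poly (map_poly of_rat q) x = 0 \<longrightarrow> degree p \<le> degree q)" for p :: "rat poly"
  have dvd: "p dvd q" if "P p" "poly (map_poly of_rat q) x = 0" for p q
    using that minimal_degree_dvd[of p x q] unfolding P_def by force
  obtain p where p: "p \<noteq> 0" "poly (map_poly of_rat p) x = 0"
    "\<And>q. q \<noteq> 0 \<Longrightarrow> poly (map_poly of_rat q) x = 0 \<Longrightarrow> degree p \<le> degree q"
    using ex_has_least_nat[of "\<lambda>p. p \<noteq> 0 \<and> poly (map_poly of_rat p) x = 0" q0 degree] assms
    by auto
  have "map_poly of_rat (smult (inverse (lead_coeff p)) p)
      = smult (of_rat (inverse (lead_coeff p))) (map_poly (of_rat :: rat \<Rightarrow> complex) p)"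
    by (rule map_poly_smult) (auto simp: of_rat_mult)
  then have "P (smult (inverse (lead_coeff p)) p)"
    using p unfolding P_def by auto
  moreover have "p1 = p2" if P12: "P p1" "P p2" for p1 p2
  proof -
    obtain s where s: "p2 = p1 * s" using dvd[of p1 p2] P12 unfolding P_def by (meson dvdE)
    then have nz: "p1 \<noteq> 0" "s \<noteq> 0" using P12 by (auto simp: P_def)
    have "degree p2 \<le> degree p1" using nz P12 by (auto simp: P_def)
    then have "degree s = 0" using s nz by (simp add: degree_mult_eq)
    moreover have "lead_coeff s = 1" using P12 s by (simp add: P_def lead_coeff_mult)
    ultimately have "s = 1" by (auto elim!: degree_eq_zeroE)
    then show ?thesis using s by simp
  qed
  ultimately have "P (minimal_polynomial x)"
    unfolding minimal_polynomial_def P_def[symmetric] by (metis theI)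
  then show "lead_coeff (minimal_polynomial x) = 1"
    "poly (map_poly of_rat (minimal_polynomial x)) x = 0"
    "\<And>q. poly (map_poly of_rat q) x = 0 \<Longrightarrow> minimal_polynomial x dvd q"
    using dvd unfolding P_def by auto
qed

lemma minimal_polynomial_int_coeffs:
  assumes "algebraic_int x"
  shows "lead_coeff (minimal_polynomial x) = 1"
    and "poly (map_poly of_rat (minimal_polynomial x)) x = 0"
    and "coeff (minimal_polynomial x) i \<in> \<int>"
proof -
  obtain p where p: "poly (map_poly of_int p) x = 0" "lead_coeff p = 1"
    using assms by (auto simp: algebraic_int_altdef_ipoly)
  have eq: "map_poly (of_rat :: rat \<Rightarrow> complex) (map_poly of_int p) = map_poly of_int p"
    by (subst map_poly_map_poly) (auto simp: o_def)
  have nz: "map_poly rat_of_int p \<noteq> 0"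
    using p by (metis coeff_map_poly coeff_0 of_int_0 of_int_1 zero_neq_one)
  note spec = minimal_polynomial_spec[OF nz, of x, unfolded eq, OF p(1)]
  show "lead_coeff (minimal_polynomial x) = 1"
    "poly (map_poly of_rat (minimal_polynomial x)) x = 0"
    by (rule spec)+
  have "minimal_polynomial x dvd map_poly of_int p"
    using spec(3)[of "map_poly of_int p"] p(1) eq by simp
  then obtain s where "map_poly of_int p = minimal_polynomial x * s" by (elim dvdE)
  then show "coeff (minimal_polynomial x) i \<in> \<int>"
    using monic_rat_factor_of_int_poly p(2) spec(1) by blast
qed

section \<open>Conjugates\<close>

lemma conjugate_list_pos:
  assumes "algebraic_int x" "conjugate_list x n r"
  shows "n \<ge> 1"
proof (rule ccontr)
  assume "\<not> n \<ge> 1"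
  then have "map_poly (of_rat :: rat \<Rightarrow> complex) (minimal_polynomial x) = 1"
    using assms(2) by (simp add: conjugate_list_def)
  then show False using minimal_polynomial_int_coeffs(2)[OF assms(1)] by simp
qed

text \<open>The definition of a PV number bounds the conjugates in some enumeration. Cancelling the factor
  of \<open>x\<close> itself from the two factorizations transfers the bound to any other one; comparing mere
  sets of roots would not exclude that \<open>x\<close> occurs a second time.\<close>

lemma PV_number_conjugates_less_1:
  assumes "PV_number x" "conjugate_list x n r" "j \<in> {2..n}"
  shows "cmod (r j) < 1"
proof -
  obtain n' r' where c': "conjugate_list x n' r'" "\<forall>j\<in>{2..n'}. cmod (r' j) < 1"
    using assms(1) by (auto simp: PV_number_def)
  have [simp]: "n' = n" using c' assms(2) by (auto simp: conjugate_list_def)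
  have split: "(\<Prod>j=1..n. [:- t j, 1:]) = [:- t 1, 1:] * (\<Prod>j=2..n. [:- t j, 1:])"
    for t :: "nat \<Rightarrow> complex"
    using assms(3) by (subst prod.atLeast_Suc_atMost) (auto simp: numeral_2_eq_2)
  have "(\<Prod>j=1..n. [:- r j, 1:]) = (\<Prod>j=1..n. [:- r' j, 1:])"
    using c' assms(2) by (simp add: conjugate_list_def)
  then have "(\<Prod>j=2..n. [:- r j, 1:]) = (\<Prod>j=2..n. [:- r' j, 1:])"
    using c'(1) assms(2) unfolding split conjugate_list_def
    by (metis mult_cancel_left pCons_eq_0_iff zero_neq_one)
  then have "poly (\<Prod>j=2..n. [:- r' j, 1:]) (r j) = poly (\<Prod>j=2..n. [:- r j, 1:]) (r j)"
    by simp
  also have "\<dots> = 0" using assms(3) by (auto simp: poly_prod)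
  finally obtain k where "k \<in> {2..n}" "r j = r' k" by (auto simp: poly_prod)
  then show ?thesis using c'(2) by simp
qed

section \<open>Arithmetic of the quasilattice\<close>

text \<open>Multiplication by a root is the same integer operation on \<open>l\<close> for all roots: the companion
  matrix of the minimal polynomial with coefficients \<open>c\<^sub>i\<close>, which shifts \<open>l\<close> and rewrites the
  overflow \<open>l\<^sub>n z\<^sup>n\<close> by means of \<open>z\<^sup>n = - \<Sum>i<n. c\<^sub>i z\<^sup>i\<close>.\<close>

lemma companion_action:
  assumes "algebraic_int x" "conjugate_list x n r"
  obtains l' where "\<And>j. j \<in> {1..n} \<Longrightarrow>
    vandermonde_transpose_mult n r l' j = r j * vandermonde_transpose_mult n r l j"
proof -
  let ?p = "minimal_polynomial x"
  have "\<exists>c. coeff ?p i = of_int c" for i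
    using minimal_polynomial_int_coeffs(3)[OF assms(1)] by (auto elim: Ints_cases)
  then obtain c where c: "\<And>i. coeff ?p i = of_int (c i)" by metis
  have deg: "degree ?p = n" and fac: "map_poly of_rat ?p = (\<Prod>j=1..n. [:- r j, 1:])"
    using assms(2) by (auto simp: conjugate_list_def)
  obtain N where N: "n = Suc N"
    using conjugate_list_pos[OF assms] by (cases n) auto
  have cn: "c n = 1"
    using minimal_polynomial_int_coeffs(1)[OF assms(1)] c[of n] deg by simp
  define l' where "l' i = (if i = 1 then 0 else l (i - 1)) - c (i - 1) * l n" for i
  have "vandermonde_transpose_mult n r l' j = r j * vandermonde_transpose_mult n r l j"
    if j: "j \<in> {1..n}" for j
  proof -
    let ?z = "r j"
    have "poly (map_poly of_rat ?p) ?z = 0" unfolding fac using j by (auto simp: poly_prod)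
    then have "(\<Sum>i\<le>n. of_int (c i) * ?z ^ i) = 0"
      by (simp add: poly_altdef degree_map_poly coeff_map_poly c deg)
    then have top: "?z ^ Suc N = - (\<Sum>i\<le>N. of_int (c i) * ?z ^ i)"
      using cn by (simp add: N add_eq_0_iff)
    have shift: "(\<Sum>i=1..n. g i) = (\<Sum>i\<le>N. g (Suc i))" for g :: "nat \<Rightarrow> complex"
      by (simp only: N One_nat_def sum.atLeast1_atMost_eq lessThan_Suc_atMost)
    have "vandermonde_transpose_mult n r l' j = (\<Sum>i\<le>N. ?z ^ i * of_int (l' (Suc i)))"
      unfolding vandermonde_transpose_mult_def vandermonde_def shift by simp
    also have "\<dots> = (\<Sum>i\<le>N. ?z ^ i * of_int (if i = 0 then 0 else l i))
        - of_int (l n) * (\<Sum>i\<le>N. of_int (c i) * ?z ^ i)"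
      by (simp add: l'_def algebra_simps sum_subtractf sum_distrib_left cong: if_cong)
    also have "\<dots> = (\<Sum>i\<le>N. ?z ^ i * of_int (if i = 0 then 0 else l i)) + of_int (l n) * ?z ^ Suc N"
      unfolding top by simp
    also have "\<dots> = (\<Sum>i\<le>Suc N. ?z ^ i * of_int (if i = 0 then 0 else l i))"
      by (simp add: N)
    also have "\<dots> = (\<Sum>i\<le>N. ?z ^ Suc i * of_int (l (Suc i)))"
      by (subst sum.atMost_Suc_shift) simp
    also have "\<dots> = ?z * vandermonde_transpose_mult n r l j"
      unfolding vandermonde_transpose_mult_def vandermonde_def shift
      by (simp add: sum_distrib_left mult.assoc)
    finally show ?thesis .
  qed
  then show ?thesis using that by blast
qed

lemma vandermonde_transpose_mult_add:
  "vandermonde_transpose_mult n r (\<lambda>i. l i + m i) j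
     = vandermonde_transpose_mult n r l j + vandermonde_transpose_mult n r m j"
  by (simp add: vandermonde_transpose_mult_def algebra_simps sum.distrib)

lemma mult_add_in_quasilattice:
  assumes alg: "algebraic_int (complex_of_real lam)"
    and conj: "conjugate_list (complex_of_real lam) n r"
    and t: "t \<in> quasilattice n r \<sigma>"
    and s: "s \<in> quasilattice n r (\<lambda>j. if j = 1 then 0 else (1 - cmod (r j)) * \<sigma> j)"
  shows "lam * t + s \<in> quasilattice n r \<sigma>"
proof -
  obtain l where l: "complex_of_real t = vandermonde_transpose_mult n r l 1"
    "\<And>j. j \<in> {2..n} \<Longrightarrow> cmod (vandermonde_transpose_mult n r l j) < \<sigma> j"
    using t by (auto simp: quasilattice_def)
  obtain m where m: "complex_of_real s = vandermonde_transpose_mult n r m 1"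
    "\<And>j. j \<in> {2..n} \<Longrightarrow> cmod (vandermonde_transpose_mult n r m j) < (1 - cmod (r j)) * \<sigma> j"
    using s by (force simp: quasilattice_def)
  obtain l' where l': "\<And>j. j \<in> {1..n} \<Longrightarrow>
      vandermonde_transpose_mult n r l' j = r j * vandermonde_transpose_mult n r l j"
    using companion_action[OF alg conj] by blast
  let ?v = "vandermonde_transpose_mult n r (\<lambda>i. l' i + m i)"
  have "r 1 = complex_of_real lam" using conj by (simp add: conjugate_list_def)
  then have "complex_of_real (lam * t + s) = ?v 1"
    using conjugate_list_pos[OF alg conj] l(1) m(1) l'[of 1]
    by (simp add: vandermonde_transpose_mult_add)
  moreover have "cmod (?v j) < \<sigma> j" if j: "j \<in> {2..n}" for j
  proof -
    have "cmod (?v j) \<le> cmod (r j) * cmod (vandermonde_transpose_mult n r l j)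
        + cmod (vandermonde_transpose_mult n r m j)"
      using l'[of j] j by (simp add: vandermonde_transpose_mult_add norm_triangle_le norm_mult)
    also have "\<dots> < cmod (r j) * \<sigma> j + (1 - cmod (r j)) * \<sigma> j"
      by (intro add_le_less_mono mult_left_mono less_imp_le[OF l(2)] m(2) j) auto
    finally show ?thesis by (simp add: algebra_simps)
  qed
  ultimately show ?thesis by (auto simp: quasilattice_def)
qed

lemma admissible_scaled:
  assumes PV: "PV_number x" and conj: "conjugate_list x n r" and \<sigma>: "\<sigma> \<in> admissible n r"
  shows "(\<lambda>j. if j = 1 then 0 else (1 - cmod (r j)) * \<sigma> j) \<in> admissible n r"
proof -
  have "(1 - cmod (r j)) * \<sigma> j = (1 - cmod (r k)) * \<sigma> k"
    if "2 \<le> j" "j < k" "k \<le> n" "r j \<notin> \<real>" "r k = cnj (r j)" for j k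
  proof -
    have "\<sigma> j = \<sigma> k" using that \<sigma> unfolding admissible_def by blast
    then show ?thesis using that by simp
  qed
  then show ?thesis
    using \<sigma> PV_number_conjugates_less_1[OF PV conj] by (auto simp: admissible_def)
qed

section \<open>Refinement of the scaling spaces\<close>

text \<open>The span is defined by sums over finite subsets without repetitions, so sums of two
  combinations are formed over the union of the two subsets, with coefficients extended by 0.\<close>

lemma complex_span_combine:
  assumes "u \<in> complex_span S" "v \<in> complex_span S"
  shows "(\<lambda>\<phi>. u \<phi> + b * v \<phi>) \<in> complex_span S"
proof -
  obtain T c where T: "finite T" "T \<subseteq> S" "u = (\<lambda>\<phi>. \<Sum>w\<in>T. c w * w \<phi>)"
    using assms(1) by (auto simp: complex_span_def)
  obtain R d where R: "finite R" "R \<subseteq> S" "v = (\<lambda>\<phi>. \<Sum>w\<in>R. d w * w \<phi>)"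
    using assms(2) by (auto simp: complex_span_def)
  define e where "e w = (if w \<in> T then c w else 0) + b * (if w \<in> R then d w else 0)" for w
  have "u \<phi> = (\<Sum>w\<in>T \<union> R. (if w \<in> T then c w else 0) * w \<phi>)" for \<phi>
    unfolding T(3) using T(1) R(1) by (intro sum.mono_neutral_cong_left) auto
  moreover have "v \<phi> = (\<Sum>w\<in>T \<union> R. (if w \<in> R then d w else 0) * w \<phi>)" for \<phi>
    unfolding R(3) using T(1) R(1) by (intro sum.mono_neutral_cong_left) auto
  ultimately have "(\<lambda>\<phi>. u \<phi> + b * v \<phi>) = (\<lambda>\<phi>. \<Sum>w\<in>T \<union> R. e w * w \<phi>)"
    by (simp add: e_def sum_distrib_left sum.distrib algebra_simps)
  moreover have "finite (T \<union> R)" "T \<union> R \<subseteq> S" using T R by auto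
  ultimately show ?thesis unfolding complex_span_def by blast
qed

lemma complex_span_sum:
  assumes "finite I" "\<And>i. i \<in> I \<Longrightarrow> g i \<in> complex_span S"
  shows "(\<lambda>\<phi>. \<Sum>i\<in>I. b i * g i \<phi>) \<in> complex_span S"
  using assms
proof (induction I rule: finite_induct)
  case empty
  show ?case unfolding complex_span_def by (auto intro!: exI[of _ "{}"])
next
  case (insert i I)
  then have "(\<lambda>\<phi>. (\<Sum>i\<in>I. b i * g i \<phi>) + b i * g i \<phi>) \<in> complex_span S"
    by (intro complex_span_combine) auto
  then show ?case using insert.hyps by (simp add: add.commute)
qed

lemma complex_span_superset:
  assumes "u \<in> S" shows "u \<in> complex_span S"
proof -
  have "u = (\<lambda>\<phi>. \<Sum>w\<in>{u}. 1 * w \<phi>)" by simp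
  then show ?thesis using assms unfolding complex_span_def
    by (intro CollectI exI[of _ "{u}"] exI[of _ "\<lambda>_. 1"]) auto
qed

lemma complex_span_minimal:
  assumes "S \<subseteq> complex_span R"
  shows "complex_span S \<subseteq> complex_span R"
proof
  fix u assume "u \<in> complex_span S"
  then obtain T c where "finite T" "T \<subseteq> S" "u = (\<lambda>\<phi>. \<Sum>w\<in>T. c w * w \<phi>)"
    by (auto simp: complex_span_def)
  then show "u \<in> complex_span R"
    using complex_span_sum[of T "\<lambda>w. w" R c] assms by blast
qed

text \<open>The distributional form of \<open>f(\<lambda>(b x - t) - s) = f(\<lambda>b x - (\<lambda>t + s))\<close>.\<close>

lemma affine_pullback_affine_pullback:
  assumes "b \<noteq> 0" "lam \<noteq> 0"
  shows "affine_pullback b t (affine_pullback lam s f) = affine_pullback (b * lam) (lam * t + s) f"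
proof
  fix \<phi> :: "real \<Rightarrow> complex"
  have "((y + s) / lam + t) / b = (y + (lam * t + s)) / (b * lam)" for y
    using assms by (simp add: field_simps)
  then show "affine_pullback b t (affine_pullback lam s f) \<phi>
      = affine_pullback (b * lam) (lam * t + s) f \<phi>"
    by (simp add: affine_pullback_def abs_mult)
qed

lemma scaling_space_mono:
  fixes a :: "nat \<Rightarrow> complex"
  assumes "lam \<noteq> 0"
    and refine: "f = (\<lambda>\<phi>. \<Sum>j=1..m. a j * affine_pullback lam (\<tau> j) f \<phi>)"
    and L: "\<And>t j. t \<in> L \<Longrightarrow> j \<in> {1..m} \<Longrightarrow> lam * t + \<tau> j \<in> L"
  shows "scaling_space lam L f k \<subseteq> scaling_space lam L f (k + 1)"
  unfolding scaling_space_def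
proof (intro complex_span_minimal image_subsetI)
  fix t assume t: "t \<in> L"
  let ?W = "complex_span ((\<lambda>\<tau>. affine_pullback (lam powi (k + 1)) \<tau> f) ` L)"
  have pw: "lam powi (k + 1) = lam powi k * lam"
    using \<open>lam \<noteq> 0\<close> by (simp add: power_int_add_1)
  have "affine_pullback (lam powi k) t f \<phi>
      = (\<Sum>j=1..m. a j * affine_pullback (lam powi k) t (affine_pullback lam (\<tau> j) f) \<phi>)" for \<phi>
    unfolding affine_pullback_def[of "lam powi k"] by (rule fun_cong[OF refine])
  then have "affine_pullback (lam powi k) t f
      = (\<lambda>\<phi>. \<Sum>j=1..m. a j * affine_pullback (lam powi (k + 1)) (lam * t + \<tau> j) f \<phi>)"
    using \<open>lam \<noteq> 0\<close> by (simp add: fun_eq_iff affine_pullback_affine_pullback pw)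
  also have "\<dots> \<in> ?W"
    by (intro complex_span_sum complex_span_superset imageI L t) auto
  finally show "affine_pullback (lam powi k) t f \<in> ?W" .
qed

theorem theorem4:
  fixes lam :: real and n :: nat and r :: "nat \<Rightarrow> complex" and \<sigma> \<xi> :: "nat \<Rightarrow> real"
  assumes "PV_number (complex_of_real lam)"
    and "\<bar>lam\<bar> > 1"
    and "conjugate_list (complex_of_real lam) n r"
    and "\<bar>coeff (minimal_polynomial (complex_of_real lam)) 0\<bar> = 1"
    and "\<sigma> \<in> admissible n r"
    and "\<xi> = (\<lambda>j. if j = 1 then 0 else (1 - cmod (r j)) * \<sigma> j)"
  shows "\<xi> \<in> admissible n r \<and>
    (\<forall>(m::nat) (a :: nat \<Rightarrow> complex) (\<tau> :: nat \<Rightarrow> real) f.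
       m \<ge> 1 \<and> (\<forall>j\<in>{1..m}. a j \<noteq> 0) \<and> (\<Sum>j=1..m. a j) = complex_of_real \<bar>lam\<bar> \<and>
       strict_mono_on {1..m} \<tau> \<and> (\<forall>j\<in>{1..m}. \<tau> j \<in> quasilattice n r \<xi>) \<and>
       f \<in> compactly_supported_distributions \<and> dist_integral f = 1 \<and>
       f = (\<lambda>\<phi>. \<Sum>j=1..m. a j * affine_pullback lam (\<tau> j) f \<phi>) \<longrightarrow>
       (\<forall>k::int. scaling_space lam (quasilattice n r \<sigma>) f k
                  \<subseteq> scaling_space lam (quasilattice n r \<sigma>) f (k + 1)))"
proof (intro conjI allI impI)
  show "\<xi> \<in> admissible n r"
    using admissible_scaled[OF assms(1,3,5)] assms(6) by simp
next
  fix m :: nat and a :: "nat \<Rightarrow> complex" and \<tau> :: "nat \<Rightarrow> real" and f and k :: int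
  assume A: "m \<ge> 1 \<and> (\<forall>j\<in>{1..m}. a j \<noteq> 0) \<and> (\<Sum>j=1..m. a j) = complex_of_real \<bar>lam\<bar> \<and>
       strict_mono_on {1..m} \<tau> \<and> (\<forall>j\<in>{1..m}. \<tau> j \<in> quasilattice n r \<xi>) \<and>
       f \<in> compactly_supported_distributions \<and> dist_integral f = 1 \<and>
       f = (\<lambda>\<phi>. \<Sum>j=1..m. a j * affine_pullback lam (\<tau> j) f \<phi>)"
  have alg: "algebraic_int (complex_of_real lam)" using assms(1) by (simp add: PV_number_def)
  show "scaling_space lam (quasilattice n r \<sigma>) f k
      \<subseteq> scaling_space lam (quasilattice n r \<sigma>) f (k + 1)"
  proof (rule scaling_space_mono)
    show "lam \<noteq> 0" using assms(2) by auto
    show "f = (\<lambda>\<phi>. \<Sum>j=1..m. a j * affine_pullback lam (\<tau> j) f \<phi>)" using A by (elim conjE)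
    fix t j assume "t \<in> quasilattice n r \<sigma>" "j \<in> {1..m}"
    then show "lam * t + \<tau> j \<in> quasilattice n r \<sigma>"
      using A assms(6) mult_add_in_quasilattice[OF alg assms(3)] by blast
  qed
qed

end
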